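(* Let $G$ be a graph of order $n$ and average degree $d$ with $0<d<n-1$, and let $d_+$ be a real number with $d_+\in\left(\sqrt{dn},n-1\right]$. Then there is a vertex $u$ in $G$ with $$d_+-\frac{(d_+-d)n}{n-d_++\sqrt{d_+^2-dn}}\leq d_G(u)\leq d_+.$$
   Context: All graphs are finite, simple, and undirected. The order of a graph is its number of vertices, $d_G(u)$ denotes the degree of the vertex $u$ in $G$, and the average degree of a graph with $n$ vertices and $m$ edges is $\frac{2m}{n}$. *)

theory Defs
  imports Complex_Main "Graph_Theory.Digraph"
begin

text \<open>
  The locale \<^locale>\<open>graph\<close> represents a finite simple undirected graph as a finite symmetric
  digraph without loops and parallel arcs: an undirected edge is a pair of mutually reverse arcs.
  Edges must therefore be counted as two-element vertex sets, not as arcs.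
\<close>

definition edges :: "('a, 'b) pre_digraph \<Rightarrow> 'a set set" where
  "edges G = (\<lambda>e. {tail G e, head G e}) ` arcs G"

definition average_degree :: "('a, 'b) pre_digraph \<Rightarrow> real" where
  "average_degree G = 2 * real (card (edges G)) / real (card (verts G))"

text \<open>
  In a \<^locale>\<open>graph\<close>, \<^const>\<open>out_degree\<close> is the usual degree, i.e. the number of incident edges.
\<close>

lemma (in graph) out_degree_eq_card_incident_edges:
  "out_degree G u = card {e \<in> edges G. u \<in> e}"
proof -
  have inj: "inj_on (\<lambda>e. {tail G e, head G e}) (out_arcs G u)"
    by (rule inj_onI, rule no_multi_arcs) (auto simp: out_arcs_def arc_to_ends_def doubleton_eq_iff)
  have "{e \<in> edges G. u \<in> e} = (\<lambda>e. {tail G e, head G e}) ` out_arcs G u"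
  proof (intro equalityI subsetI)
    fix x assume "x \<in> {e \<in> edges G. u \<in> e}"
    then obtain e where e: "e \<in> arcs G" "x = {tail G e, head G e}" "u = tail G e \<or> u = head G e"
      by (auto simp: edges_def)
    show "x \<in> (\<lambda>e. {tail G e, head G e}) ` out_arcs G u"
    proof (cases "u = tail G e")
      case True
      then show ?thesis using e by (auto simp: out_arcs_def)
    next
      case False
      then have u: "u = head G e" using e by simp
      have "(tail G e, head G e) \<in> arcs_ends G"
        using e(1) by (auto simp: arcs_ends_def arc_to_ends_def)
      then have "(head G e, tail G e) \<in> arcs_ends G"
        using sym_arcs by (auto simp: symmetric_def dest: symD)
      then obtain e' where "e' \<in> arcs G" "tail G e' = head G e" "head G e' = tail G e"
        by (auto simp: arcs_ends_def arc_to_ends_def)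
      then have "e' \<in> out_arcs G u" "x = {tail G e', head G e'}"
        using u e(2) by (auto simp: out_arcs_def)
      then show ?thesis by blast
    qed
  qed (auto simp: edges_def out_arcs_def)
  then show ?thesis by (simp only: out_degree_def card_image[OF inj])
qed

end

theory Submission
  imports Defs
begin

text \<open>
  Put \<open>s = sqrt (d_plus\<^sup>2 - d n)\<close>, let \<open>m\<close> be the claimed lower bound, and suppose that no degree lies
  between \<open>m\<close> and \<open>d_plus\<close>. Then the vertices split into a set \<open>A\<close> of \<open>k\<close> vertices of degree above
  \<open>d_plus\<close> and a set \<open>B\<close> of \<open>n - k\<close> vertices of degree below \<open>m\<close>. Two things limit the degree sum
  \<open>S\<^sub>A\<close> of \<open>A\<close>: trivially \<open>S\<^sub>A \<le> k n\<close>, and, since an edge leaving \<open>A\<close> also contributes to the degree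
  sum \<open>S\<^sub>B\<close> of \<open>B\<close>, also \<open>S\<^sub>A \<le> k\<^sup>2 + S\<^sub>B\<close>. The handshake lemma gives \<open>S\<^sub>A + S\<^sub>B = d n\<close>. These
  facts already contradict \<open>S\<^sub>A \<ge> k d_plus\<close> and \<open>S\<^sub>B < (n - k) m\<close>.

  This becomes transparent in complementary quantities \<open>x = n - k\<close>,
  \<open>y = n - d_plus + s\<close> and \<open>q = sqrt (n\<^sup>2 - d n)\<close>, because the bound \<open>m\<close> satisfies
  \<open>2 (n - m) = y + q\<^sup>2 / y\<close>. By the inequality of arithmetic and geometric means, \<open>n - m \<ge> q\<close>.
  From \<open>k d_plus \<le> S\<^sub>A \<le> (k\<^sup>2 + d n) / 2\<close> one obtains \<open>y \<le> x\<close>. From \<open>S\<^sub>A \<le> k n\<close> one obtains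
  \<open>x (n - m) < q\<^sup>2\<close>, hence \<open>x < q\<close>. From \<open>S\<^sub>A \<le> k\<^sup>2 + S\<^sub>B\<close> one obtains
  \<open>2 (n - m) < x + q\<^sup>2 / x\<close>. But \<open>z + q\<^sup>2 / z\<close> decreases for \<open>0 < z \<le> q\<close>, so the last inequality
  contradicts \<open>y \<le> x < q\<close>.
\<close>

section \<open>Degree sums over sets of vertices\<close>

lemma (in graph) finite_edges: "finite (edges G)"
  by (simp add: edges_def)

lemma (in graph) edge_subset_verts:
  assumes "e \<in> edges G"
  shows "e \<subseteq> verts G"
  using assms by (auto simp: edges_def)

lemma (in graph) card_edge:
  assumes "e \<in> edges G"
  shows "card e = 2"
  using assms no_loops by (fastforce simp: edges_def)

text \<open>
  Counting incidences between \<open>S\<close> and the edges in two ways turns statements about degree sums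
  into statements about single edges.
\<close>

lemma (in graph) sum_out_degree_eq_sum_edges:
  assumes "finite S"
  shows "(\<Sum>u\<in>S. out_degree G u) = (\<Sum>e\<in>edges G. card (e \<inter> S))"
proof -
  have "(\<Sum>u\<in>S. out_degree G u) = (\<Sum>u\<in>S. \<Sum>e\<in>edges G. if u \<in> e then 1 else 0)"
    by (simp add: out_degree_eq_card_incident_edges sum.If_cases finite_edges Int_def)
  also have "\<dots> = (\<Sum>e\<in>edges G. \<Sum>u\<in>S. if u \<in> e then 1 else 0)"
    by (rule sum.swap)
  also have "\<dots> = (\<Sum>e\<in>edges G. card (e \<inter> S))"
    using assms by (simp add: sum.If_cases Int_def conj_commute)
  finally show ?thesis .
qed

lemma (in graph) handshake:
  "(\<Sum>u\<in>verts G. out_degree G u) = 2 * card (edges G)"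
  by (simp add: sum_out_degree_eq_sum_edges card_edge Int_absorb2 edge_subset_verts)

lemma (in graph) out_degree_le_card_verts:
  "out_degree G u \<le> card (verts G)"
proof -
  have "{e \<in> edges G. u \<in> e} \<subseteq> (\<lambda>v. {u, v}) ` verts G"
    by (auto simp: edges_def insert_commute)
  then show ?thesis
    unfolding out_degree_eq_card_incident_edges by (rule surj_card_le[rotated]) simp
qed

text \<open>
  An edge has more ends in \<open>A\<close> than outside only if it lies inside \<open>A\<close>; it then has an excess of two,
  and there are at most \<open>card A choose 2\<close> such edges.
\<close>

lemma (in graph) sum_out_degree_le_square_plus_rest:
  assumes "A \<subseteq> verts G"
  shows "(\<Sum>u\<in>A. out_degree G u) \<le> (card A)\<^sup>2 + (\<Sum>u\<in>verts G - A. out_degree G u)"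
proof -
  have finA: "finite A" using assms finite_subset[of A "verts G"] by auto
  have "card (e \<inter> A) \<le> card (e \<inter> (verts G - A)) + (if e \<subseteq> A then 2 else 0)"
    if e: "e \<in> edges G" for e
  proof (cases "e \<subseteq> A")
    case True
    then show ?thesis using card_edge[OF e] by (simp add: Int_absorb2)
  next
    case False
    have fin: "finite e" using edge_subset_verts[OF e] finite_subset[of e "verts G"] by auto
    have "card (e \<inter> A) < 2"
      using psubset_card_mono[OF fin, of "e \<inter> A"] False card_edge[OF e] by auto
    moreover have "card (e \<inter> (verts G - A)) > 0"
      using False edge_subset_verts[OF e] fin by (auto simp: card_gt_0_iff)
    ultimately show ?thesis by simp
  qed
  then have "(\<Sum>u\<in>A. out_degree G u)
      \<le> (\<Sum>e\<in>edges G. card (e \<inter> (verts G - A)) + (if e \<subseteq> A then 2 else 0))"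
    unfolding sum_out_degree_eq_sum_edges[OF finA] by (intro sum_mono)
  also have "\<dots> = (\<Sum>u\<in>verts G - A. out_degree G u) + card {e \<in> edges G. e \<subseteq> A} * 2"
    by (simp add: sum.distrib sum_out_degree_eq_sum_edges sum.If_cases finite_edges Int_def)
  finally have le: "(\<Sum>u\<in>A. out_degree G u)
      \<le> (\<Sum>u\<in>verts G - A. out_degree G u) + card {e \<in> edges G. e \<subseteq> A} * 2" .
  have "card {e \<in> edges G. e \<subseteq> A} \<le> card {e. e \<subseteq> A \<and> card e = 2}"
    using finA card_edge by (intro card_mono) auto
  also have "\<dots> = card A choose 2"
    using finA by (rule n_subsets)
  finally have "card {e \<in> edges G. e \<subseteq> A} * 2 \<le> card A * (card A - 1)"
    unfolding choose_two by linarith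
  also have "\<dots> \<le> (card A)\<^sup>2"
    by (simp add: power2_eq_square)
  finally show ?thesis using le by linarith
qed

section \<open>Incompatibility of the degree-sum constraints\<close>

text \<open>
  \<open>1 - q\<^sup>2 / (x y)\<close> is the slope of a chord of the convex function \<open>z \<mapsto> z + q\<^sup>2 / z\<close>, and it is
  negative on the left of the minimum at \<open>q\<close>.
\<close>

lemma add_square_divide_antimono:
  fixes x y q :: real
  assumes "0 < y" "y \<le> x" "x \<le> q"
  shows "x + q\<^sup>2 / x \<le> y + q\<^sup>2 / y"
proof -
  have "x * y \<le> q\<^sup>2"
    unfolding power2_eq_square using assms by (intro mult_mono) auto
  then have "(x - y) * (x * y) \<le> (x - y) * q\<^sup>2"
    using assms by (intro mult_left_mono) auto
  then show ?thesis
    using assms by (simp add: field_simps power2_eq_square)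
qed

text \<open>
  Here \<open>k\<close>, \<open>SA\<close> and \<open>SB\<close> are the number of vertices of high degree, their degree sum, and the degree
  sum of the other vertices, but only the inequalities between these numbers matter.
\<close>

lemma degree_sum_constraints_incompatible:
  fixes n d D k SA SB :: real
  defines "s \<equiv> sqrt (D\<^sup>2 - d * n)"
  defines "m \<equiv> D - (D - d) * n / (n - D + s)"
  assumes "d * n < D\<^sup>2" "D \<le> n" "0 \<le> n" "d \<le> n" "k < D"
    and total: "SA + SB = d * n"
    and high: "k * D \<le> SA"
    and low: "SB < (n - k) * m"
    and trivial_bound: "SA \<le> k * n"
    and crossing_bound: "SA \<le> k\<^sup>2 + SB"
  shows False
proof -
  define x where "x = n - k"
  define y where "y = n - D + s"
  define q where "q = sqrt (n\<^sup>2 - d * n)"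
  have s: "s > 0" "s\<^sup>2 = D\<^sup>2 - d * n"
    using assms(3) by (auto simp: s_def)
  have x: "x > 0" and y: "y > 0"
    using \<open>D \<le> n\<close> \<open>k < D\<close> s(1) by (simp_all add: x_def y_def)
  have q: "q \<ge> 0" "q\<^sup>2 = n\<^sup>2 - d * n"
    using \<open>0 \<le> n\<close> \<open>d \<le> n\<close> by (auto simp: q_def power2_eq_square mult_right_mono)
  have "y * m = y * D - (D - d) * n"
    using y by (simp add: m_def y_def field_simps)
  then have "y * (2 * (n - m)) = y\<^sup>2 + q\<^sup>2"
    using s(2) unfolding y_def q(2) by (simp add: algebra_simps power2_eq_square)
  then have m: "2 * (n - m) = y + q\<^sup>2 / y"
    using y by (simp add: field_simps power2_eq_square)

  \<comment> \<open>This is \<open>(D - k)\<^sup>2 \<ge> s\<^sup>2\<close>; of its two solution ranges, \<open>k < D\<close> selects \<open>k \<le> D - s\<close>.\<close>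
  have "2 * (k * D) \<le> k\<^sup>2 + d * n"
    using high crossing_bound total by linarith
  then have "s\<^sup>2 \<le> (D - k)\<^sup>2"
    unfolding s(2) power2_diff by (simp add: mult.commute mult.left_commute)
  then have "s \<le> D - k"
    by (rule power2_le_imp_le) (use \<open>k < D\<close> in simp)
  then have "y \<le> x" by (simp add: x_def y_def)

  have "0 \<le> (y - q)\<^sup>2 / y" using y by simp
  also have "\<dots> = y + q\<^sup>2 / y - 2 * q"
    using y by (simp add: field_simps power2_eq_square)
  finally have "q \<le> n - m" unfolding m[symmetric] by simp
  then have "x * q \<le> x * (n - m)" using x by (intro mult_left_mono) auto
  also have "\<dots> < q\<^sup>2"
    using total low trivial_bound unfolding x_def q(2) by (simp add: algebra_simps power2_eq_square)
  finally have "x < q" using q(1) by (simp add: power2_eq_square mult_less_cancel_right)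

  have "x * (2 * (n - m)) < x\<^sup>2 + q\<^sup>2"
    using total low crossing_bound unfolding x_def q(2)
    by (simp add: algebra_simps power2_eq_square)
  then have "2 * (n - m) < x + q\<^sup>2 / x"
    using x by (simp add: field_simps power2_eq_square)
  then show False
    unfolding m using add_square_divide_antimono[OF y \<open>y \<le> x\<close>, of q] \<open>x < q\<close> by simp
qed

section \<open>A vertex with degree in the prescribed interval\<close>

theorem theorem2:
  fixes G :: "('a, 'b) pre_digraph" and n :: nat and d d_plus :: real
  assumes "graph G"
    and "n = card (verts G)"
    and "d = average_degree G"
    and "0 < d" and "d < real n - 1"
    and "d_plus \<in> {sqrt (d * real n)<..real n - 1}"
  shows "\<exists>u \<in> verts G.
    d_plus - (d_plus - d) * real n / (real n - d_plus + sqrt (d_plus\<^sup>2 - d * real n))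
      \<le> real (out_degree G u)
    \<and> real (out_degree G u) \<le> d_plus"
proof (rule ccontr)
  define m where
    "m = d_plus - (d_plus - d) * real n / (real n - d_plus + sqrt (d_plus\<^sup>2 - d * real n))"
  define deg where "deg u = real (out_degree G u)" for u
  define A where "A = {u \<in> verts G. d_plus < deg u}"
  define B where "B = verts G - A"
  assume "\<not> ?thesis"
  then have low: "deg u < m" if "u \<in> B" for u
    using that unfolding A_def B_def m_def deg_def by force

  interpret graph G by fact
  have fin: "finite A" and sub: "A \<subseteq> verts G"
    by (auto simp: A_def)
  have cardB: "real (card B) = real n - real (card A)"
    using fin sub assms(2) by (simp add: B_def card_Diff_subset card_mono of_nat_diff)

  have root: "sqrt (d * real n) \<ge> 0" "sqrt (d * real n) < d_plus"
    using assms(4,6) by auto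
  have D: "d_plus > 0" "d * real n < d_plus\<^sup>2" "d_plus \<le> real n"
  proof -
    show "d_plus > 0" using root by linarith
    have "(sqrt (d * real n))\<^sup>2 < d_plus\<^sup>2"
      using root by (intro power_strict_mono) auto
    then show "d * real n < d_plus\<^sup>2" using assms(4) by simp
    show "d_plus \<le> real n" using assms(6) by simp
  qed
  have "n > 0" using assms(4,5) by simp
  then have "sum deg (verts G) = d * real n"
    using handshake assms(2,3)
    by (auto simp: deg_def average_degree_def simp flip: of_nat_sum)
  then have total: "sum deg A + sum deg B = d * real n"
    using sum.subset_diff[OF sub, of deg] by (simp add: B_def)
  have "sum deg B \<ge> 0" by (simp add: deg_def sum_nonneg)
  \<comment> \<open>Since \<open>d n < d_plus\<^sup>2\<close>, the degree sum leaves room for fewer than \<open>d_plus\<close> vertices of high degree.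
    Hence \<open>B\<close> is nonempty, which makes the bound on its degree sum strict.\<close>
  have high: "real (card A) * d_plus \<le> sum deg A"
    using sum_bounded_below[of A d_plus deg] by (simp add: A_def)
  also have "\<dots> < d_plus * d_plus"
    using total \<open>sum deg B \<ge> 0\<close> D(2) by (simp add: power2_eq_square)
  finally have card_less: "real (card A) < d_plus" using D(1) by simp
  then have "B \<noteq> {}" using cardB D(3) by auto
  then have "sum deg B < (\<Sum>u\<in>B. m)"
    using low by (intro sum_strict_mono) (auto simp: B_def)
  then have low_sum: "sum deg B < (real n - real (card A)) * m" using cardB by simp
  have trivial_bound: "sum deg A \<le> real (card A) * real n"
    using out_degree_le_card_verts assms(2)
    by (intro sum_bounded_above) (simp add: deg_def)
  have crossing_bound: "sum deg A \<le> (real (card A))\<^sup>2 + sum deg B"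
    using of_nat_mono[OF sum_out_degree_le_square_plus_rest[OF sub], where 'a = real]
    by (simp add: deg_def B_def)
  have "d \<le> real n" using assms(5) by simp
  show False
    using degree_sum_constraints_incompatible[OF D(2,3) of_nat_0_le_iff \<open>d \<le> real n\<close> card_less total high
        low_sum[unfolded m_def] trivial_bound crossing_bound] .
qed

end
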